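(* For all integers $m,n\ge 3$, \[ q_B(C_m\square C_n)= \begin{cases} 5,&\text{if at least one of }m,n\text{ is odd};\\ 5,&\text{if }\{m,n\}=\{4,4k+2\}\text{ for some integer }k\ge 1;\\ 4,&\text{otherwise}. \end{cases} \]
   Context: All graphs are finite and simple. An edge-coloring is proper if incident (i.e. sharing an endpoint) distinct edges receive distinct colors. A set of edges is rainbow if its edges have pairwise distinct colors. A B-coloring of a graph $G$ is a proper edge-coloring of $G$ in which every $4$-cycle (cycle subgraph of length $4$, not necessarily induced) is rainbow. The B-coloring number $q_B(G)$ is the minimum number of colors in a B-coloring of $G$. $C_n$ denotes the cycle on $n$ vertices ($n\ge 3$). The Cartesian product $G\square H$ has vertex set $V(G)\times V(H)$, with $(u,x)$ adjacent to $(v,y)$ if and only if $uv\in E(G)$ and $x=y$, or $u=v$ and $xy\in E(H)$. *)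

theory Defs
  imports Main
begin

text \<open>A graph is a vertex set together with a set of unordered pairs of vertices. Undirected
  edges (rather than a symmetric arc relation) are what an edge-coloring assigns colors to.\<close>

record 'a graph =
  verts :: "'a set"
  edges :: "'a set set"

definition simple_graph :: "'a graph \<Rightarrow> bool" where
  "simple_graph G \<longleftrightarrow> finite (verts G) \<and> (\<forall>e\<in>edges G. e \<subseteq> verts G \<and> card e = 2)"

definition adj :: "'a graph \<Rightarrow> 'a \<Rightarrow> 'a \<Rightarrow> bool" where
  "adj G u v \<longleftrightarrow> {u, v} \<in> edges G"

text \<open>For \<open>n \<ge> 3\<close> this is the usual cycle; it is not meant to be used for smaller \<open>n\<close>.\<close>

definition cycle_graph :: "nat \<Rightarrow> nat graph" where
  "cycle_graph n = \<lparr>verts = {..<n}, edges = {{i, Suc i mod n} | i. i < n}\<rparr>"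

definition cart_prod :: "'a graph \<Rightarrow> 'b graph \<Rightarrow> ('a \<times> 'b) graph"  (infixr "\<box>" 70) where
  "G \<box> H =
    \<lparr>verts = verts G \<times> verts H,
     edges = {{(u, x), (v, y)} | u x v y.
       (u, x) \<in> verts G \<times> verts H \<and> (v, y) \<in> verts G \<times> verts H \<and>
       (adj G u v \<and> x = y \<or> u = v \<and> adj H x y)}\<rparr>"

definition proper_edge_coloring :: "'a graph \<Rightarrow> ('a set \<Rightarrow> 'c) \<Rightarrow> bool" where
  "proper_edge_coloring G c \<longleftrightarrow>
    (\<forall>e\<in>edges G. \<forall>f\<in>edges G. e \<noteq> f \<and> e \<inter> f \<noteq> {} \<longrightarrow> c e \<noteq> c f)"

definition rainbow :: "('a set \<Rightarrow> 'c) \<Rightarrow> 'a set set \<Rightarrow> bool" where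
  "rainbow c F \<longleftrightarrow> inj_on c F"

text \<open>The edge sets of the (not necessarily induced) cycle subgraphs of length 4.\<close>

definition four_cycles :: "'a graph \<Rightarrow> 'a set set set" where
  "four_cycles G = {{{p, q}, {q, r}, {r, s}, {s, p}} | p q r s.
     distinct [p, q, r, s] \<and> adj G p q \<and> adj G q r \<and> adj G r s \<and> adj G s p}"

definition B_coloring :: "'a graph \<Rightarrow> ('a set \<Rightarrow> 'c) \<Rightarrow> bool" where
  "B_coloring G c \<longleftrightarrow> proper_edge_coloring G c \<and> (\<forall>F\<in>four_cycles G. rainbow c F)"

text \<open>The colors counted are those actually used on the edges. As graphs are finite, natural
  numbers provide enough colors.\<close>

definition B_coloring_number :: "'a graph \<Rightarrow> nat"  ("q\<^sub>B") where
  "q\<^sub>B G = (LEAST k. \<exists>c :: 'a set \<Rightarrow> nat. B_coloring G c \<and> card (c ` edges G) = k)"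


lemma simple_graph_cycle_graph:
  assumes "n \<ge> 3"
  shows "simple_graph (cycle_graph n)"
proof -
  have "i \<noteq> Suc i mod n" if "i < n" for i
    using that assms by (cases "Suc i = n") auto
  moreover have "Suc i mod n < n" for i
    using assms by simp
  ultimately show ?thesis
    by (auto simp: simple_graph_def cycle_graph_def card_2_iff)
qed

lemma simple_graph_cart_prod:
  assumes "simple_graph G" "simple_graph H"
  shows "simple_graph (G \<box> H)"
proof -
  have G: "u \<noteq> v" if "adj G u v" for u v
    using assms(1) that by (force simp: simple_graph_def adj_def)
  have H: "x \<noteq> y" if "adj H x y" for x y
    using assms(2) that by (force simp: simple_graph_def adj_def)
  show ?thesis
    unfolding simple_graph_def
  proof (intro conjI ballI)
    show "finite (verts (G \<box> H))"
      using assms by (simp add: simple_graph_def cart_prod_def)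
  next
    fix e assume "e \<in> edges (G \<box> H)"
    then obtain u x v y where e: "e = {(u, x), (v, y)}"
      and mem: "(u, x) \<in> verts G \<times> verts H" "(v, y) \<in> verts G \<times> verts H"
      and uxvy: "adj G u v \<and> x = y \<or> u = v \<and> adj H x y"
      by (auto simp: cart_prod_def)
    show "e \<subseteq> verts (G \<box> H)"
      using e mem by (simp add: cart_prod_def)
    have "(u, x) \<noteq> (v, y)"
      using uxvy G H by blast
    then show "card e = 2"
      using e by simp
  qed
qed

text \<open>The minimum defining the B-coloring number of a finite simple graph is attained.\<close>

lemma B_coloring_number_attained:
  assumes "simple_graph G"
  shows "\<exists>c :: 'a set \<Rightarrow> nat. B_coloring (G :: 'a graph) c \<and> card (c ` edges G) = q\<^sub>B G"
proof -
  have "edges G \<subseteq> Pow (verts G)"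
    using assms by (auto simp: simple_graph_def)
  moreover have "finite (Pow (verts G))"
    using assms by (simp add: simple_graph_def)
  ultimately have "finite (edges G)"
    by (rule finite_subset)
  then obtain c :: "'a set \<Rightarrow> nat" where c: "inj_on c (edges G)"
    using finite_imp_inj_to_nat_seg by blast
  have "rainbow c F" if F: "F \<in> four_cycles G" for F
  proof -
    have "F \<subseteq> edges G"
      using F by (auto simp: four_cycles_def adj_def)
    then show ?thesis
      using c unfolding rainbow_def by (rule inj_on_subset[rotated])
  qed
  moreover have "proper_edge_coloring G c"
    using c by (auto simp: proper_edge_coloring_def inj_on_def)
  ultimately have "\<exists>k. \<exists>c :: 'a set \<Rightarrow> nat. B_coloring G c \<and> card (c ` edges G) = k"
    unfolding B_coloring_def by blast
  then show ?thesis
    unfolding B_coloring_number_def by (rule LeastI_ex)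
qed

end

theory Submission
  imports Defs
begin

text \<open>The four edges at a vertex need four colors, and cutting both cycles into blocks of lengths 3, 4
  and 5 reduces 5-colorings of all tori to one finite table. If there are only four
  colors, unroll the torus to the plane and place the colors at the midpoints of the edges: the midpoints
  form a tilted square lattice, and each of its unit squares, coming from a vertex or a face, shows all
  four colors. Such a pattern is 2-periodic along all rows or along all columns, with neighboring
  lines using complementary pairs of colors. Going once around the torus, by \<open>m\<close> or \<open>n\<close> lines, must therefore
  exchange the pairs an even number of times, so \<open>m\<close> and \<open>n\<close> are even. If \<open>m = 4\<close>, the rainbow rows
  force the pattern to change after two lines and hence to have period 4 across the lines,
  which contradicts the period \<open>n\<close> if \<open>n\<close> is 2 modulo 4.\<close>

section \<open>Colorings of the torus as pairs of functions\<close>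

definition hedge :: "nat \<Rightarrow> nat \<Rightarrow> nat \<Rightarrow> (nat \<times> nat) set" where
  "hedge m i j = {(i, j), (Suc i mod m, j)}"

definition vedge :: "nat \<Rightarrow> nat \<Rightarrow> nat \<Rightarrow> (nat \<times> nat) set" where
  "vedge n i j = {(i, j), (i, Suc j mod n)}"

text \<open>\<open>h i j\<close> and \<open>v i j\<close> are the colors of the edges leaving
  \<open>(i, j)\<close> in the first and second direction. The vertex condition is stated at
  successors, so that the edges entering a vertex are indexed without subtraction modulo
  \<open>m\<close> or \<open>n\<close>. The last two conjuncts concern the only 4-cycles that are
  not faces: whole rows or columns of length 4.\<close>

definition torus_coloring :: "nat \<Rightarrow> nat \<Rightarrow> (nat \<Rightarrow> nat \<Rightarrow> 'c) \<Rightarrow> (nat \<Rightarrow> nat \<Rightarrow> 'c) \<Rightarrow> bool" where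
  "torus_coloring m n h v \<longleftrightarrow>
    (\<forall>i<m. \<forall>j<n.
      distinct [h i (Suc j mod n), h (Suc i mod m) (Suc j mod n),
                v (Suc i mod m) j, v (Suc i mod m) (Suc j mod n)] \<and>
      distinct [h i j, h i (Suc j mod n), v i j, v (Suc i mod m) j]) \<and>
    (m = 4 \<longrightarrow> (\<forall>j<n. inj_on (\<lambda>i. h i j) {..<m})) \<and>
    (n = 4 \<longrightarrow> (\<forall>i<m. inj_on (v i) {..<n}))"

text \<open>Reflection in the diagonal; it transfers what is proved about \<open>m\<close> to
  \<open>n\<close>.\<close>

lemma torus_coloring_swap:
  assumes "torus_coloring m n h v"
  shows "torus_coloring n m (\<lambda>i j. v j i) (\<lambda>i j. h j i)"
  unfolding torus_coloring_def
proof (intro conjI allI impI)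
  fix i j assume "i < n" "j < m"
  then have
    "distinct [h j (Suc i mod n), h (Suc j mod m) (Suc i mod n),
               v (Suc j mod m) i, v (Suc j mod m) (Suc i mod n)]"
    "distinct [h j i, h j (Suc i mod n), v j i, v (Suc j mod m) i]"
    using assms unfolding torus_coloring_def by blast+
  then show
    "distinct [v (Suc j mod m) i, v (Suc j mod m) (Suc i mod n),
               h j (Suc i mod n), h (Suc j mod m) (Suc i mod n)]"
    "distinct [v j i, v (Suc j mod m) i, h j i, h j (Suc i mod n)]"
    by auto
qed (use assms in \<open>simp_all add: torus_coloring_def\<close>)

lemma Suc_mod_eq: "i < m \<Longrightarrow> Suc i mod m = (if Suc i = m then 0 else Suc i)"
  by auto

section \<open>Vertices and edges of the torus\<close>

lemma adj_cycle_graph: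
  "adj (cycle_graph m) x y \<longleftrightarrow> x < m \<and> y < m \<and> (y = Suc x mod m \<or> x = Suc y mod m)"
  unfolding adj_def cycle_graph_def by (auto simp: doubleton_eq_iff)

lemma adj_commute: "adj G x y \<longleftrightarrow> adj G y x"
  by (simp add: adj_def insert_commute)

lemma adj_cart_prod:
  "adj (G \<box> H) p q \<longleftrightarrow> p \<in> verts G \<times> verts H \<and> q \<in> verts G \<times> verts H \<and>
    (adj G (fst p) (fst q) \<and> snd p = snd q \<or> fst p = fst q \<and> adj H (snd p) (snd q))"
    (is "_ \<longleftrightarrow> ?P p q")
proof
  have comm: "?P p q \<longleftrightarrow> ?P q p"
    using adj_commute[of G] adj_commute[of H] by (metis (no_types))
  assume "adj (G \<box> H) p q"
  then have "{p, q} \<in> edges (G \<box> H)"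
    by (simp only: adj_def)
  then have "\<exists>p' q'. {p, q} = {p', q'} \<and> ?P p' q'"
    unfolding cart_prod_def by fastforce
  then show "?P p q"
    using comm by (auto simp: doubleton_eq_iff)
next
  assume "?P p q"
  then have "{p, q} \<in> edges (G \<box> H)"
    unfolding cart_prod_def by (cases p; cases q) auto
  then show "adj (G \<box> H) p q"
    by (simp only: adj_def)
qed

lemma adj_torus:
  "adj (cycle_graph m \<box> cycle_graph n) p q \<longleftrightarrow>
    fst p < m \<and> fst q < m \<and> snd p < n \<and> snd q < n \<and>
    (adj (cycle_graph m) (fst p) (fst q) \<and> snd p = snd q \<or>
     fst p = fst q \<and> adj (cycle_graph n) (snd p) (snd q))"
proof -
  have "verts (cycle_graph k) = {..<k}" for k
    by (simp add: cycle_graph_def)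
  then show ?thesis
    unfolding adj_cart_prod by (auto simp: mem_Times_iff)
qed

lemma edges_torus:
  "edges (cycle_graph m \<box> cycle_graph n) =
    {hedge m i j | i j. i < m \<and> j < n} \<union> {vedge n i j | i j. i < m \<and> j < n}"
    (is "?E = ?R")
proof
  show "?E \<subseteq> ?R"
  proof
    fix e assume e: "e \<in> ?E"
    then obtain p q where pq: "e = {p, q}"
      unfolding cart_prod_def by auto
    then have "adj (cycle_graph m \<box> cycle_graph n) p q"
      using e by (simp add: adj_def)
    then show "e \<in> ?R"
      unfolding pq adj_torus adj_cycle_graph hedge_def vedge_def
      by (cases p; cases q) (auto simp: doubleton_eq_iff)
  qed
  have "adj (cycle_graph m \<box> cycle_graph n) (i, j) (Suc i mod m, j)"
       "adj (cycle_graph m \<box> cycle_graph n) (i, j) (i, Suc j mod n)" if "i < m" "j < n" for i j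
    using that by (auto simp: adj_torus adj_cycle_graph)
  then show "?R \<subseteq> ?E"
    unfolding hedge_def vedge_def adj_def by auto
qed

text \<open>Two different indices naming the same edge would be successors of each other, which only
  happens in length 2.\<close>

lemma cycle_edge_inj:
  assumes "3 \<le> m" "i < m" "k < m" "{i, Suc i mod m} = {k, Suc k mod m}"
  shows "i = k"
proof (rule ccontr)
  assume "i \<noteq> k"
  then have "i = Suc k mod m" "k = Suc i mod m"
    using assms(4) by (auto simp: doubleton_eq_iff)
  then show False
    using assms(1-3) by (auto simp: Suc_mod_eq split: if_splits)
qed

lemma hedge_eq_iff:
  assumes "3 \<le> m" "i < m" "i' < m"
  shows "hedge m i j = hedge m i' j' \<longleftrightarrow> i = i' \<and> j = j'"
proof
  assume eq: "hedge m i j = hedge m i' j'"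
  have "{i, Suc i mod m} = {i', Suc i' mod m}"
    using arg_cong[OF eq, of "image fst"] by (simp add: hedge_def)
  moreover have "j = j'"
    using arg_cong[OF eq, of "image snd"] by (simp add: hedge_def)
  ultimately show "i = i' \<and> j = j'"
    using cycle_edge_inj assms by blast
qed simp

lemma vedge_eq_iff:
  assumes "3 \<le> n" "j < n" "j' < n"
  shows "vedge n i j = vedge n i' j' \<longleftrightarrow> i = i' \<and> j = j'"
proof
  assume eq: "vedge n i j = vedge n i' j'"
  have "{j, Suc j mod n} = {j', Suc j' mod n}"
    using arg_cong[OF eq, of "image snd"] by (simp add: vedge_def)
  moreover have "i = i'"
    using arg_cong[OF eq, of "image fst"] by (simp add: vedge_def)
  ultimately show "i = i' \<and> j = j'"
    using cycle_edge_inj assms by blast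
qed simp

text \<open>The second projection collapses a horizontal edge to a point, but not a vertical
  one.\<close>

lemma hedge_neq_vedge:
  assumes "3 \<le> n" "j' < n"
  shows "hedge m i j \<noteq> vedge n i' j'"
proof
  assume eq: "hedge m i j = vedge n i' j'"
  have "snd ` hedge m i j = {j}" "snd ` vedge n i' j' = {j', Suc j' mod n}"
    by (simp_all add: hedge_def vedge_def)
  then have "{j', Suc j' mod n} = {j}"
    using eq by metis
  then have "Suc j' mod n \<in> {j}" "j' \<in> {j}"
    by blast+
  then show False
    using assms by (auto simp: Suc_mod_eq split: if_splits)
qed

text \<open>Every index is a successor, so conditions stated at successor vertices reach all
  vertices.\<close>

lemma Suc_mod_surj:
  assumes "i < (m::nat)"
  obtains k where "k < m" "i = Suc k mod m"
proof (cases i)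
  case 0
  then show ?thesis using assms that[of "m - 1"] by simp
next
  case (Suc k)
  then show ?thesis using assms that[of k] by simp
qed

lemma Suc_mod_inj:
  assumes "Suc i mod m = Suc k mod m" "i < m" "k < m"
  shows "i = k"
  using assms by (auto simp: Suc_mod_eq split: if_splits)

lemma torus_edge_at_vertex:
  assumes "e \<in> edges (cycle_graph m \<box> cycle_graph n)"
    and "(Suc i mod m, Suc j mod n) \<in> e" and "i < m" "j < n"
  shows "e \<in> {hedge m i (Suc j mod n), hedge m (Suc i mod m) (Suc j mod n),
              vedge n (Suc i mod m) j, vedge n (Suc i mod m) (Suc j mod n)}"
proof -
  from assms(1) consider
      (h) a b where "a < m" "b < n" "e = hedge m a b"
    | (v) a b where "a < m" "b < n" "e = vedge n a b"
    unfolding edges_torus by blast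
  then show ?thesis
  proof cases
    case h
    then have "b = Suc j mod n" "a = Suc i mod m \<or> a = i"
      using assms(2) Suc_mod_inj[OF _ assms(3) h(1)] unfolding h(3) hedge_def by blast+
    then show ?thesis
      using h(3) by blast
  next
    case v
    then have "a = Suc i mod m" "b = Suc j mod n \<or> b = j"
      using assms(2) Suc_mod_inj[OF _ assms(4) v(2)] unfolding v(3) vedge_def by blast+
    then show ?thesis
      using v(3) by blast
  qed
qed

text \<open>A closed walk through four distinct vertices never turns back. It therefore keeps its
  direction, and four steps lead back to the start only if the length divides 4.\<close>

lemma cycle_graph_closed_walk_4:
  assumes m: "3 \<le> m" and d: "distinct [p, q, r, s]"
    and A: "adj (cycle_graph m) p q" "adj (cycle_graph m) q r"
      "adj (cycle_graph m) r s" "adj (cycle_graph m) s p"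
  shows "m = 4"
proof -
  have round: "m = 4" if "b = Suc a mod m" "c = Suc b mod m" "d = Suc c mod m" "a = Suc d mod m"
    "a < m" "b < m" "c < m" "d < m" for a b c d
    using that m by (auto simp: Suc_mod_eq split: if_splits)
  have step: "y = Suc x mod m \<and> z = Suc y mod m \<or> y = Suc z mod m \<and> x = Suc y mod m"
    if "adj (cycle_graph m) x y" "adj (cycle_graph m) y z" "x \<noteq> z" for x y z
    using that Suc_mod_inj[of x m z] unfolding adj_cycle_graph by auto
  have neq: "x \<noteq> Suc y mod m" if "y = Suc x mod m" "x < m" "y < m" for x y
    using that m by (auto simp: Suc_mod_eq split: if_splits)
  have b: "p < m" "q < m" "r < m" "s < m"
    using A by (auto simp: adj_cycle_graph)
  have "p \<noteq> r" "q \<noteq> s" "r \<noteq> p" "s \<noteq> q"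
    using d by auto
  note S = step[OF A(1,2) this(1)] step[OF A(2,3) this(2)] step[OF A(3,4) this(3)] step[OF A(4,1) this(4)]
  show ?thesis
  proof (cases "q = Suc p mod m")
    case True
    then have r: "r = Suc q mod m"
      using S(1) neq[OF True b(1,2)] by metis
    then have s: "s = Suc r mod m"
      using S(2) neq[OF r b(2,3)] by metis
    then have "p = Suc s mod m"
      using S(3) neq[OF s b(3,4)] by metis
    then show ?thesis
      using round[OF True r s] b by blast
  next
    case False
    then have *: "q = Suc r mod m" "p = Suc q mod m" "s = Suc p mod m"
      using S(1,4) by metis+
    then have "r = Suc s mod m"
      using S(3) neq[OF *(3) b(1,4)] by metis
    then show ?thesis
      using round[OF *(1,2,3)] b by blast
  qed
qed

section \<open>Translating B-colorings into pairs of functions and back\<close>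

text \<open>Properness separates neighboring edges of a 4-cycle. Of its two opposite pairs, one
  becomes the other when the cycle is rotated by one vertex.\<close>

lemma B_coloringI:
  assumes proper: "proper_edge_coloring G c"
    and opp: "\<And>p q r s. distinct [p, q, r, s] \<Longrightarrow> adj G p q \<Longrightarrow> adj G q r \<Longrightarrow> adj G r s \<Longrightarrow>
      adj G s p \<Longrightarrow> c {p, q} \<noteq> c {r, s}"
  shows "B_coloring G c"
  unfolding B_coloring_def
proof (intro conjI ballI)
  fix F assume "F \<in> four_cycles G"
  then obtain p q r s where F: "F = {{p, q}, {q, r}, {r, s}, {s, p}}"
    and d: "distinct [p, q, r, s]" and a: "adj G p q" "adj G q r" "adj G r s" "adj G s p"
    unfolding four_cycles_def by blast
  have "c {p, q} \<noteq> c {r, s}" "c {q, r} \<noteq> c {s, p}"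
    using opp[of p q r s] opp[of q r s p] d a by auto
  moreover have "c {x, y} \<noteq> c {y, z}" if "adj G x y" "adj G y z" "x \<noteq> z" for x y z
    using proper that unfolding proper_edge_coloring_def adj_def
    by (smt (verit) disjoint_iff doubleton_eq_iff insertCI)
  then have "c {p, q} \<noteq> c {q, r}" "c {q, r} \<noteq> c {r, s}" "c {r, s} \<noteq> c {s, p}" "c {s, p} \<noteq> c {p, q}"
    using d a by auto
  ultimately show "rainbow c F"
    unfolding rainbow_def F inj_on_def by auto
qed (fact proper)

lemma B_coloring_torusI:
  fixes c :: "(nat \<times> nat) set \<Rightarrow> 'c"
  assumes mn: "3 \<le> m" "3 \<le> n" and T: "torus_coloring m n h v"
    and ch: "\<And>i j. i < m \<Longrightarrow> j < n \<Longrightarrow> c (hedge m i j) = h i j"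
    and cv: "\<And>i j. i < m \<Longrightarrow> j < n \<Longrightarrow> c (vedge n i j) = v i j"
  shows "B_coloring (cycle_graph m \<box> cycle_graph n) c" (is "B_coloring ?G c")
proof (rule B_coloringI)
  have less [simp]: "Suc i mod m < m" "Suc i mod n < n" for i
    using mn by auto
  show "proper_edge_coloring ?G c"
    unfolding proper_edge_coloring_def
  proof (intro ballI impI)
    fix e f assume e: "e \<in> edges ?G" and f: "f \<in> edges ?G" and ef: "e \<noteq> f \<and> e \<inter> f \<noteq> {}"
    then obtain p where p: "p \<in> e" "p \<in> f"
      by blast
    then have "fst p < m" "snd p < n"
      using e by (auto simp: edges_torus hedge_def vedge_def)
    \<comment> \<open>The common endpoint is written as a pair of successors, where the vertex
      condition applies.\<close>
    then obtain i j where ij: "i < m" "fst p = Suc i mod m" "j < n" "snd p = Suc j mod n"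
      by (metis Suc_mod_surj)
    let ?i = "Suc i mod m" and ?j = "Suc j mod n"
    have "p = (?i, ?j)"
      using ij by (simp add: prod_eq_iff)
    then have "e \<in> {hedge m i ?j, hedge m ?i ?j, vedge n ?i j, vedge n ?i ?j}"
      "f \<in> {hedge m i ?j, hedge m ?i ?j, vedge n ?i j, vedge n ?i ?j}"
      using torus_edge_at_vertex[OF e] torus_edge_at_vertex[OF f] p ij by auto
    moreover have "distinct [c (hedge m i ?j), c (hedge m ?i ?j), c (vedge n ?i j), c (vedge n ?i ?j)]"
      using T ij unfolding torus_coloring_def by (simp add: ch cv)
    ultimately show "c e \<noteq> c f"
      using ef by auto
  qed
next
  fix p q r s
  assume d: "distinct [p, q, r, s]"
    and adj: "adj ?G p q" "adj ?G q r" "adj ?G r s" "adj ?G s p"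
  have irrefl: "\<not> adj (cycle_graph m) a a" "\<not> adj (cycle_graph n) a a" for a
    using mn by (auto simp: adj_cycle_graph Suc_mod_eq split: if_splits)
  have less [simp]: "Suc i mod m < m" "Suc i mod n < n" for i
    using mn by auto
  obtain p1 p2 q1 q2 r1 r2 s1 s2
    where eqs: "p = (p1, p2)" "q = (q1, q2)" "r = (r1, r2)" "s = (s1, s2)"
    by (metis prod.exhaust)
  note A = adj[unfolded adj_torus eqs fst_conv snd_conv]
  have b: "p1 < m" "p2 < n" "q1 < m" "q2 < n" "r1 < m" "r2 < n" "s1 < m" "s2 < n"
    using A by auto
  have hc: "\<exists>i<m. {a, b} = {i, Suc i mod m} \<and> c {(a, y), (b, y)} = h i y"
    if "adj (cycle_graph m) a b" "y < n" for a b y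
  proof -
    have "a < m" "b < m" "b = Suc a mod m \<or> a = Suc b mod m"
      using that by (auto simp: adj_cycle_graph)
    then show ?thesis
      using ch[of a y] ch[of b y] that(2) by (auto simp: hedge_def insert_commute)
  qed
  have vc: "\<exists>i<n. {a, b} = {i, Suc i mod n} \<and> c {(x, a), (x, b)} = v x i"
    if "adj (cycle_graph n) a b" "x < m" for a b x
  proof -
    have "a < n" "b < n" "b = Suc a mod n \<or> a = Suc b mod n"
      using that by (auto simp: adj_cycle_graph)
    then show ?thesis
      using cv[of x a] cv[of x b] that(2) by (auto simp: vedge_def insert_commute)
  qed
  have face: "distinct [h i j, h i (Suc j mod n), v i j, v (Suc i mod m) j]" if "i < m" "j < n" for i j
    using T that unfolding torus_coloring_def by blast
  \<comment> \<open>A closed walk of length 4 through distinct vertices stays in one row, stays in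
    one column, or alternates directions around a face; any other mixture repeats a vertex or fails
    to return.\<close>
  consider
      (hh) "adj (cycle_graph m) p1 q1" "adj (cycle_graph m) q1 r1" "adj (cycle_graph m) r1 s1"
        "adj (cycle_graph m) s1 p1" "p2 = q2" "r2 = q2" "s2 = q2"
    | (vv) "adj (cycle_graph n) p2 q2" "adj (cycle_graph n) q2 r2" "adj (cycle_graph n) r2 s2"
        "adj (cycle_graph n) s2 p2" "p1 = q1" "r1 = q1" "s1 = q1"
    | (hv) "adj (cycle_graph m) p1 q1" "adj (cycle_graph n) q2 r2" "p2 = q2" "r2 = s2" "p1 = s1" "q1 = r1"
    | (vh) "adj (cycle_graph n) p2 q2" "adj (cycle_graph m) q1 r1" "p1 = q1" "r1 = s1" "p2 = s2" "q2 = r2"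
    using A d irrefl unfolding eqs by auto
  then show "c {p, q} \<noteq> c {r, s}"
  proof cases
    case hh
    have "m = 4"
      using cycle_graph_closed_walk_4[OF mn(1) _ hh(1-4)] d hh(5-7) unfolding eqs by auto
    then have inj: "inj_on (\<lambda>i. h i q2) {..<m}"
      using T b unfolding torus_coloring_def by blast
    obtain i where i: "i < m" "{p1, q1} = {i, Suc i mod m}" "c {p, q} = h i q2"
      using hc[OF hh(1) b(4)] hh unfolding eqs by auto
    obtain k where k: "k < m" "{r1, s1} = {k, Suc k mod m}" "c {r, s} = h k q2"
      using hc[OF hh(3) b(4)] hh unfolding eqs by auto
    have "i \<noteq> k"
      using i k d hh(5-7) unfolding eqs by (auto simp: doubleton_eq_iff)
    then show ?thesis
      using inj i k by (auto simp: inj_on_def)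
  next
    case vv
    have "n = 4"
      using cycle_graph_closed_walk_4[OF mn(2) _ vv(1-4)] d vv(5-7) unfolding eqs by auto
    then have inj: "inj_on (v q1) {..<n}"
      using T b unfolding torus_coloring_def by blast
    obtain i where i: "i < n" "{p2, q2} = {i, Suc i mod n}" "c {p, q} = v q1 i"
      using vc[OF vv(1) b(3)] vv unfolding eqs by auto
    obtain k where k: "k < n" "{r2, s2} = {k, Suc k mod n}" "c {r, s} = v q1 k"
      using vc[OF vv(3) b(3)] vv unfolding eqs by auto
    have "i \<noteq> k"
      using i k d vv(5-7) unfolding eqs by (auto simp: doubleton_eq_iff)
    then show ?thesis
      using inj i k by (auto simp: inj_on_def)
  next
    case hv
    have pq: "p1 < m" "q1 < m" "q1 = Suc p1 mod m \<or> p1 = Suc q1 mod m"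
      using hv by (auto simp: adj_cycle_graph)
    obtain i where i: "i < m" "\<And>y. y < n \<Longrightarrow> c {(p1, y), (q1, y)} = h i y"
      using pq ch[of p1] ch[of q1] by (auto simp: hedge_def insert_commute)
    have "q2 < n" "r2 < n" "r2 = Suc q2 mod n \<or> q2 = Suc r2 mod n"
      using hv by (auto simp: adj_cycle_graph)
    then have "h i q2 \<noteq> h i r2"
      using face[OF i(1), of q2] face[OF i(1), of r2] by auto
    then show ?thesis
      using i(2)[OF b(4)] i(2)[OF b(6)] hv unfolding eqs by (auto simp: insert_commute)
  next
    case vh
    have pq: "p2 < n" "q2 < n" "q2 = Suc p2 mod n \<or> p2 = Suc q2 mod n"
      using vh by (auto simp: adj_cycle_graph)
    obtain i where i: "i < n" "\<And>x. x < m \<Longrightarrow> c {(x, p2), (x, q2)} = v x i"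
      using pq cv[of _ p2] cv[of _ q2] by (auto simp: vedge_def insert_commute)
    have "q1 < m" "r1 < m" "r1 = Suc q1 mod m \<or> q1 = Suc r1 mod m"
      using vh by (auto simp: adj_cycle_graph)
    then have "v q1 i \<noteq> v r1 i"
      using face[OF _ i(1), of q1] face[OF _ i(1), of r1] by auto
    then show ?thesis
      using i(2)[OF b(3)] i(2)[OF b(5)] vh unfolding eqs by (auto simp: insert_commute)
  qed
qed

lemma B_coloring_number_torus_le:
  fixes h v :: "nat \<Rightarrow> nat \<Rightarrow> nat"
  assumes mn: "3 \<le> m" "3 \<le> n" and T: "torus_coloring m n h v"
    and hv: "\<And>i j. i < m \<Longrightarrow> j < n \<Longrightarrow> h i j < k \<and> v i j < k"
  shows "q\<^sub>B (cycle_graph m \<box> cycle_graph n) \<le> k"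
proof -
  \<comment> \<open>The description is unique, because an edge has only one name among the
    \<open>hedge\<close> and \<open>vedge\<close> terms with indices in range.\<close>
  define c :: "(nat \<times> nat) set \<Rightarrow> nat" where
    "c e = (THE x. \<exists>i<m. \<exists>j<n. e = hedge m i j \<and> x = h i j \<or> e = vedge n i j \<and> x = v i j)" for e
  have ch: "c (hedge m i j) = h i j" if "i < m" "j < n" for i j
    unfolding c_def using that mn
    by (intro the_equality) (auto simp: hedge_eq_iff hedge_neq_vedge)
  have cv: "c (vedge n i j) = v i j" if "i < m" "j < n" for i j
    unfolding c_def using that mn
    by (intro the_equality) (auto simp: vedge_eq_iff hedge_neq_vedge hedge_neq_vedge[symmetric])
  let ?G = "cycle_graph m \<box> cycle_graph n"
  have "B_coloring ?G c"
    using B_coloring_torusI[OF mn T] ch cv by blast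
  then have "q\<^sub>B ?G \<le> card (c ` edges ?G)"
    unfolding B_coloring_number_def by (intro Least_le) auto
  also have "c ` edges ?G \<subseteq> {..<k}"
    using hv ch cv by (auto simp: edges_torus)
  then have "card (c ` edges ?G) \<le> k"
    using card_mono[OF finite_lessThan] by fastforce
  finally show ?thesis .
qed

lemma rainbow_4:
  assumes "rainbow c {{p, q}, {q, r}, {r, s}, {s, p}}" "distinct [p, q, r, s]"
  shows "distinct [c {p, q}, c {q, r}, c {r, s}, c {s, p}]"
  using assms unfolding rainbow_def inj_on_def by (auto simp: doubleton_eq_iff)

lemma inj_on_lessThan_4:
  assumes "distinct [f 0, f 1, f 2, f (3::nat)]"
  shows "inj_on f {..<4}"
proof -
  have "{..<4} = set [0, 1, 2, 3::nat]"
    by auto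
  moreover have "distinct (map f [0, 1, 2, 3])"
    using assms by (simp only: list.map)
  ultimately show ?thesis
    by (simp only: distinct_map)
qed

text \<open>The edges in the vertex condition share an endpoint, those in the face condition form a
  4-cycle, and a row or column of length 4 is itself a 4-cycle.\<close>

lemma torus_coloring_of_B_coloring:
  assumes mn: "3 \<le> m" "3 \<le> n" and B: "B_coloring (cycle_graph m \<box> cycle_graph n) c"
  shows "torus_coloring m n (\<lambda>i j. c (hedge m i j)) (\<lambda>i j. c (vedge n i j))"
proof -
  let ?G = "cycle_graph m \<box> cycle_graph n"
  have less [simp]: "Suc i mod m < m" "Suc i mod n < n" for i
    using mn by auto
  have neq: "Suc i mod m \<noteq> i" if "i < m" for i
    using mn that by (auto simp: Suc_mod_eq)
  have neq': "Suc i mod n \<noteq> i" if "i < n" for i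
    using mn that by (auto simp: Suc_mod_eq)
  have E: "hedge m i j \<in> edges ?G" "vedge n i j \<in> edges ?G" if "i < m" "j < n" for i j
    using that unfolding edges_torus by auto
  have proper: "c e \<noteq> c f" if "e \<in> edges ?G" "f \<in> edges ?G" "e \<noteq> f" "p \<in> e" "p \<in> f" for e f p
    using B that unfolding B_coloring_def proper_edge_coloring_def by blast
  have cyc: "distinct [c {p, q}, c {q, r}, c {r, s}, c {s, p}]"
    if "distinct [p, q, r, s]" "adj ?G p q" "adj ?G q r" "adj ?G r s" "adj ?G s p" for p q r s
  proof (rule rainbow_4[OF _ that(1)])
    have "{{p, q}, {q, r}, {r, s}, {s, p}} \<in> four_cycles ?G"
      using that unfolding four_cycles_def by blast
    then show "rainbow c {{p, q}, {q, r}, {r, s}, {s, p}}"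
      using B unfolding B_coloring_def by blast
  qed
  show ?thesis
    unfolding torus_coloring_def
  proof (intro conjI allI impI)
    fix i j assume ij: "i < m" "j < n"
    let ?i = "Suc i mod m" and ?j = "Suc j mod n"
    have *: "(?i, ?j) \<in> hedge m i ?j" "(?i, ?j) \<in> hedge m ?i ?j" "(?i, ?j) \<in> vedge n ?i j"
       "(?i, ?j) \<in> vedge n ?i ?j"
      unfolding hedge_def vedge_def by auto
    have ne: "i \<noteq> ?i" "j \<noteq> ?j"
      using neq neq' ij by metis+
    then have "hedge m i ?j \<noteq> hedge m ?i ?j" "vedge n ?i j \<noteq> vedge n ?i ?j"
      using hedge_eq_iff[OF mn(1) ij(1) less(1)] vedge_eq_iff[OF mn(2) ij(2) less(2)] by metis+
    then show "distinct [c (hedge m i ?j), c (hedge m ?i ?j), c (vedge n ?i j), c (vedge n ?i ?j)]"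
      using proper[OF _ _ _ *(1) *(2)] proper[OF _ _ _ *(1) *(3)] proper[OF _ _ _ *(1) *(4)]
        proper[OF _ _ _ *(2) *(3)] proper[OF _ _ _ *(2) *(4)] proper[OF _ _ _ *(3) *(4)]
        E ij by (simp add: hedge_neq_vedge[OF mn(2)])
    \<comment> \<open>The edges are reoriented to run cyclically around the face, as
      \<open>cyc\<close> expects.\<close>
    have eqs: "hedge m i j = {(i, j), (?i, j)}" "vedge n ?i j = {(?i, j), (?i, ?j)}"
      "hedge m i ?j = {(?i, ?j), (i, ?j)}" "vedge n i j = {(i, ?j), (i, j)}"
      by (auto simp: hedge_def vedge_def)
    have rotate: "distinct [x, y, z, w] \<Longrightarrow> distinct [x, z, w, y]" for x y z w :: 'a
      by auto
    have "distinct [c (hedge m i j), c (vedge n ?i j), c (hedge m i ?j), c (vedge n i j)]"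
      unfolding eqs
      by (rule cyc) (use ij ne less in \<open>simp_all add: adj_torus adj_cycle_graph\<close>)
    then show "distinct [c (hedge m i j), c (hedge m i ?j), c (vedge n i j), c (vedge n ?i j)]"
      by (rule rotate)
  next
    fix j assume m: "m = 4" and j: "j < n"
    have eqs: "hedge m 0 j = {(0, j), (1, j)}" "hedge m 1 j = {(1, j), (2, j)}"
      "hedge m 2 j = {(2, j), (3, j)}" "hedge m 3 j = {(3, j), (0, j)}"
      by (simp_all add: m hedge_def Suc_eq_plus1 del: One_nat_def)
    have "distinct [c (hedge m 0 j), c (hedge m 1 j), c (hedge m 2 j), c (hedge m 3 j)]"
      unfolding eqs
      by (rule cyc) (use m j in \<open>simp_all add: adj_torus adj_cycle_graph\<close>)
    then show "inj_on (\<lambda>i. c (hedge m i j)) {..<m}"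
      unfolding m by (rule inj_on_lessThan_4)
  next
    fix i assume n: "n = 4" and i: "i < m"
    have eqs: "vedge n i 0 = {(i, 0), (i, 1)}" "vedge n i 1 = {(i, 1), (i, 2)}"
      "vedge n i 2 = {(i, 2), (i, 3)}" "vedge n i 3 = {(i, 3), (i, 0)}"
      by (simp_all add: n vedge_def Suc_eq_plus1 del: One_nat_def)
    have "distinct [c (vedge n i 0), c (vedge n i 1), c (vedge n i 2), c (vedge n i 3)]"
      unfolding eqs
      by (rule cyc) (use n i in \<open>simp_all add: adj_torus adj_cycle_graph\<close>)
    then show "inj_on (\<lambda>j. c (vedge n i j)) {..<n}"
      unfolding n by (rule inj_on_lessThan_4)
  qed
qed


section \<open>Periodic colorings with four and five colors\<close>

lemma distinct_mod_4: "distinct [x mod 4, (x + 1) mod 4, (x + 2) mod 4, (x + 3) mod (4::nat)]"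
proof -
  have *: "distinct [r, (r + 1) mod 4, (r + 2) mod 4, (r + 3) mod 4]"
    if "r = 0 \<or> r = 1 \<or> r = 2 \<or> r = 3" for r :: nat
    using that by (elim disjE) simp_all
  have "x mod 4 = 0 \<or> x mod 4 = 1 \<or> x mod 4 = 2 \<or> x mod 4 = 3"
    by linarith
  from *[OF this] show ?thesis
    by (simp only: mod_add_left_eq)
qed

lemma distinct_4_permute:
  assumes "distinct [a, b, c, d]"
  shows "distinct [d, a, c, b]" "distinct [a, d, b, c]"
  using assms by auto

text \<open>The factor 3 stands for -1: modulo 4, horizontal edges get \<open>i - j\<close> and
  vertical ones \<open>i - j + 1\<close>. Each vertex and each face sees four consecutive residues,
  and the color moves by one along every row and column, so lines of length 4 are rainbow.\<close>

lemma torus_coloring_mod4: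
  assumes "3 \<le> m" "3 \<le> n" "4 dvd m" "4 dvd n"
  shows "torus_coloring m n (\<lambda>i j. (i + 3 * j) mod 4) (\<lambda>i j. (i + 3 * j + 1) mod 4)"
  unfolding torus_coloring_def
proof (intro conjI allI impI)
  fix i j
  let ?i = "Suc i mod m" and ?j = "Suc j mod n"
  have M: "?i mod 4 = Suc i mod 4" "?j mod 4 = Suc j mod 4"
    using assms by (simp_all add: mod_mod_cancel)
  have "(i + 3 * ?j) mod 4 = (i + 3 * Suc j) mod 4" "(?i + 3 * ?j) mod 4 = (Suc i + 3 * Suc j) mod 4"
    "(?i + 3 * j + 1) mod 4 = (Suc i + 3 * j + 1) mod 4"
    "(?i + 3 * ?j + 1) mod 4 = (Suc i + 3 * Suc j + 1) mod 4"
    by (intro mod_add_cong mod_mult_cong refl M)+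
  moreover have "i + 3 * Suc j = i + 3 * j + 3" "Suc i + 3 * Suc j = i + 3 * j + 4"
    "Suc i + 3 * j + 1 = i + 3 * j + 2" "Suc i + 3 * Suc j + 1 = i + 3 * j + 1 + 4"
    by simp_all
  ultimately have eqs: "(i + 3 * ?j) mod 4 = (i + 3 * j + 3) mod 4" "(?i + 3 * ?j) mod 4 = (i + 3 * j) mod 4"
    "(?i + 3 * j + 1) mod 4 = (i + 3 * j + 2) mod 4" "(?i + 3 * ?j + 1) mod 4 = (i + 3 * j + 1) mod 4"
    by (simp_all only: mod_add_self2)
  show
    "distinct [(i + 3 * ?j) mod 4, (?i + 3 * ?j) mod 4, (?i + 3 * j + 1) mod 4, (?i + 3 * ?j + 1) mod 4]"
    "distinct [(i + 3 * j) mod 4, (i + 3 * ?j) mod 4, (i + 3 * j + 1) mod 4, (?i + 3 * j + 1) mod 4]"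
    unfolding eqs
    by (rule distinct_4_permute(1)[OF distinct_mod_4], rule distinct_4_permute(2)[OF distinct_mod_4])
next
  fix j :: nat assume m: "m = 4"
  have "distinct [(0 + 3 * j) mod 4, (1 + 3 * j) mod 4, (2 + 3 * j) mod 4, (3 + 3 * j) mod 4]"
    using distinct_mod_4[of "3 * j"] unfolding add.commute[of _ "3 * j"] add_0_right .
  then show "inj_on (\<lambda>i. (i + 3 * j) mod 4) {..<m}"
    unfolding m by (rule inj_on_lessThan_4)
next
  fix i :: nat assume n: "n = 4"
  have "i + 3 * 0 + 1 = i + 1" "i + 3 * 1 + 1 = i + 4" "i + 3 * 2 + 1 = i + 3 + 4"
    "i + 3 * 3 + 1 = i + 2 + 4 + 4"
    by simp_all
  then have "distinct [(i + 3 * 0 + 1) mod 4, (i + 3 * 1 + 1) mod 4, (i + 3 * 2 + 1) mod 4, (i + 3 * 3 + 1) mod 4]"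
    using distinct_mod_4[of i] by (simp only: mod_add_self2) auto
  then show "inj_on (\<lambda>j. (i + 3 * j + 1) mod 4) {..<n}"
    unfolding n by (rule inj_on_lessThan_4)
qed

text \<open>A checkerboard with colors 0, 1 on horizontal and 2, 3 on vertical edges. Every row and
  column has only two colors, which is why length 4 is excluded.\<close>

lemma torus_coloring_parity:
  assumes "3 \<le> m" "3 \<le> n" "even m" "even n" "m \<noteq> 4" "n \<noteq> 4"
  shows "torus_coloring m n (\<lambda>i j. (i + j) mod 2) (\<lambda>i j. 2 + (i + j) mod 2)"
  unfolding torus_coloring_def
proof (intro conjI allI impI)
  fix i j
  let ?i = "Suc i mod m" and ?j = "Suc j mod n"
  have M: "?i mod 2 = Suc i mod 2" "?j mod 2 = Suc j mod 2"
    using assms by (simp_all add: mod_mod_cancel)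
  have "(i + ?j) mod 2 = (i + Suc j) mod 2" "(?i + ?j) mod 2 = (Suc i + Suc j) mod 2"
    "(?i + j) mod 2 = (Suc i + j) mod 2"
    by (intro mod_add_cong refl M)+
  then have eqs: "(i + ?j) mod 2 = 1 - (i + j) mod 2" "(?i + ?j) mod 2 = (i + j) mod 2"
    "(?i + j) mod 2 = 1 - (i + j) mod 2"
    by (simp_all add: mod_Suc)
  have D: "distinct [1 - x, x, 2 + (1 - x), 2 + x]" "distinct [x, 1 - x, 2 + x, 2 + (1 - x)]"
    if "x = 0 \<or> x = 1" for x :: nat
    using that by auto
  have parity: "(i + j) mod 2 = 0 \<or> (i + j) mod 2 = 1"
    by linarith
  show
    "distinct [(i + ?j) mod 2, (?i + ?j) mod 2, 2 + (?i + j) mod 2, 2 + (?i + ?j) mod 2]"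
    "distinct [(i + j) mod 2, (i + ?j) mod 2, 2 + (i + j) mod 2, 2 + (?i + j) mod 2]"
    unfolding eqs by (rule D(1)[OF parity], rule D(2)[OF parity])
qed (use assms in simp_all)

section \<open>Five colors: patterns assembled from blocks\<close>

text \<open>A cycle of length \<open>n \<ge> 3\<close> is cut into blocks of length 3 followed by at most one block of
  length 4 or 5. The positions in these three kinds of blocks are numbered 0-2, 3-6 and 7-11.\<close>

definition block_pos :: "nat \<Rightarrow> nat \<Rightarrow> nat" where
  "block_pos n i =
    (let b = (if n mod 3 = 0 then n else n - 3 - n mod 3)
     in if i < b then i mod 3 else (if n mod 3 = 1 then 3 else 7) + (i - b))"

text \<open>The pairs of positions that can follow each other around a cycle. From
  \<open>(2, 3)\<close> on come the passages into and out of a last block of length 4 or 5;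
  \<open>(6, 3)\<close> and \<open>(11, 7)\<close> close cycles made of that block alone.\<close>

definition block_steps :: "(nat \<times> nat) list" where
  "block_steps =
    [(0, 1), (1, 2), (2, 0), (3, 4), (4, 5), (5, 6), (7, 8), (8, 9), (9, 10), (10, 11),
     (2, 3), (6, 0), (6, 3), (2, 7), (11, 0), (11, 7)]"

text \<open>The table was found by computer search, with the symmetry that reflecting the torus in the
  diagonal exchanges horizontal and vertical edges and permutes the colors by \<open>flip_color\<close>.\<close>

definition color_table :: "nat list list" where
  "color_table =
    [[1, 2, 4, 1, 2, 3, 0, 1, 4, 1, 0, 4],
     [0, 1, 3, 0, 1, 4, 2, 0, 2, 4, 2, 3],
     [2, 3, 0, 2, 3, 0, 4, 2, 1, 0, 3, 0],
     [1, 2, 4, 1, 2, 4, 0, 1, 4, 1, 0, 4],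
     [0, 1, 3, 0, 1, 2, 4, 0, 1, 4, 2, 3],
     [3, 0, 2, 3, 0, 1, 2, 3, 0, 3, 4, 2],
     [2, 4, 0, 2, 3, 0, 1, 2, 3, 0, 1, 0],
     [1, 2, 4, 1, 2, 4, 0, 1, 3, 1, 0, 4],
     [3, 1, 2, 3, 1, 3, 4, 3, 1, 3, 4, 1],
     [4, 2, 0, 4, 2, 0, 3, 4, 3, 0, 2, 3],
     [3, 0, 4, 3, 0, 1, 2, 3, 2, 1, 0, 2],
     [2, 3, 0, 2, 3, 0, 4, 2, 1, 3, 1, 0]]"

definition flip_color :: "nat \<Rightarrow> nat" where
  "flip_color x = [1, 0, 3, 2, 4] ! x"

definition block_h :: "nat \<Rightarrow> nat \<Rightarrow> nat" where
  "block_h a b = color_table ! a ! b"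

definition block_v :: "nat \<Rightarrow> nat \<Rightarrow> nat" where
  "block_v a b = flip_color (color_table ! b ! a)"

text \<open>Vertex and face conditions involve a single step in each direction, so evaluating all
  pairs of the 16 steps settles every torus at once.\<close>

lemma block_steps_valid:
  "\<forall>(a, a') \<in> set block_steps. \<forall>(b, b') \<in> set block_steps.
    distinct [block_h a b', block_h a' b', block_v a' b, block_v a' b'] \<and>
    distinct [block_h a b, block_h a b', block_v a b, block_v a' b]"
  by code_simp

text \<open>A cycle of length 4 is a single block at positions 3 to 6, so only these have to give
  rainbow lines.\<close>

lemma block_4_valid:
  "\<forall>b \<in> set [0..<12]. distinct (map (\<lambda>i. block_h i b) [3..<7]) \<and> distinct (map (block_v b) [3..<7])"
  by code_simp

lemma block_colors:
  "\<forall>a \<in> set [0..<12]. \<forall>b \<in> set [0..<12]. block_h a b < 5 \<and> block_v a b < 5"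
  by code_simp

lemma mod_3_step: "(i mod 3, Suc i mod 3) \<in> set block_steps"
proof -
  have "i mod 3 = 0 \<or> i mod 3 = 1 \<or> i mod 3 = 2"
    by linarith
  then show ?thesis
    by (elim disjE) (simp_all add: mod_Suc block_steps_def)
qed

lemma block_pos_step:
  assumes "3 \<le> n" "i < n"
  shows "(block_pos n i, block_pos n (Suc i mod n)) \<in> set block_steps"
proof -
  \<comment> \<open>Here \<open>a\<close> counts the blocks of length 3, and the last block has
    length \<open>Suc L\<close> and positions numbered from \<open>off\<close>. A step stays among
    the blocks of length 3, enters the last block, stays inside it, or wraps around.\<close>
  have last_block: ?thesis
    if n: "n = 3 * a + Suc L"
      and pos: "\<And>k. block_pos n k = (if k < 3 * a then k mod 3 else off + (k - 3 * a))"
      and steps: "(2, off) \<in> set block_steps" "(off + L, 0) \<in> set block_steps"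
        "(off + L, off) \<in> set block_steps"
        "\<And>d. d < L \<Longrightarrow> (off + d, off + Suc d) \<in> set block_steps" for a L off
  proof -
    consider "Suc i < 3 * a" | "Suc i = 3 * a" | d where "i = 3 * a + d" "d < L" | "i = 3 * a + L"
    proof -
      have "Suc i < 3 * a \<or> Suc i = 3 * a \<or> i = 3 * a + (i - 3 * a) \<and> i - 3 * a < L \<or> i = 3 * a + L"
        using assms(2) n by linarith
      then show thesis
        using that by blast
    qed
    then show ?thesis
    proof cases
      case 1
      then have "Suc i mod n = Suc i" "block_pos n i = i mod 3" "block_pos n (Suc i) = Suc i mod 3"
        unfolding pos by (simp_all add: n)
      then show ?thesis
        by (simp only: mod_3_step)
    next
      case 2
      then have "Suc i mod 3 = 0"
        by simp
      then have "i mod 3 = 2"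
        by (simp add: mod_Suc split: if_splits)
      moreover have "Suc i mod n = 3 * a" "block_pos n i = i mod 3" "block_pos n (3 * a) = off"
        unfolding pos using 2 by (simp_all add: n)
      ultimately show ?thesis
        using steps(1) by (simp only:)
    next
      case 3
      then have "Suc i mod n = 3 * a + Suc d"
        by (simp add: n)
      moreover have "block_pos n (3 * a + k) = off + k" for k
        unfolding pos by simp
      ultimately show ?thesis
        using steps(4) 3 by (simp only:)
    next
      case 4
      then have "Suc i mod n = 0" "block_pos n i = off + L"
        unfolding pos by (simp_all add: n)
      \<comment> \<open>The wrap-around arrives at a block of length 3 unless \<open>a = 0\<close>,
        when the last block is the whole cycle.\<close>
      moreover have "block_pos n 0 = 0 \<or> block_pos n 0 = off"
        unfolding pos by (cases a) simp_all
      ultimately show ?thesis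
        using steps(2,3) by (elim disjE) (simp_all only:)
    qed
  qed
  \<comment> \<open>A remainder of 1 or 2 modulo 3 absorbs one block of length 3.\<close>
  have "\<exists>a. n = 3 * a \<or> n = 3 * a + 4 \<or> n = 3 * a + 5"
    using assms(1) by presburger
  then obtain a where "n = 3 * a \<or> n = 3 * a + 4 \<or> n = 3 * a + 5"
    by blast
  then consider "n = 3 * a" | "n = 3 * a + 4" | "n = 3 * a + 5"
    by blast
  then show ?thesis
  proof cases
    case 1
    then have "block_pos n k = k mod 3" if "k < n" for k
      using that by (simp add: block_pos_def)
    then have "block_pos n i = i mod 3" "block_pos n (Suc i mod n) = Suc i mod n mod 3"
      using assms by simp_all
    moreover have "Suc i mod n mod 3 = Suc i mod 3"
      using 1 by (simp add: mod_mod_cancel)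
    ultimately show ?thesis
      by (simp only: mod_3_step)
  next
    case 2
    show ?thesis
    proof (rule last_block[of a 3 3])
      show "block_pos n k = (if k < 3 * a then k mod 3 else 3 + (k - 3 * a))" for k
        unfolding block_pos_def 2 by simp
      show "(3 + d, 3 + Suc d) \<in> set block_steps" if "d < 3" for d
        using that unfolding less_Suc_eq numeral_3_eq_3 by (auto simp: block_steps_def)
    qed (simp_all add: 2 block_steps_def)
  next
    case 3
    show ?thesis
    proof (rule last_block[of a 4 7])
      show "block_pos n k = (if k < 3 * a then k mod 3 else 7 + (k - 3 * a))" for k
        unfolding block_pos_def 3 by simp
      have "d = 0 \<or> d = 1 \<or> d = 2 \<or> d = 3" if "d < 4" for d :: nat
        using that by linarith
      then show "(7 + d, 7 + Suc d) \<in> set block_steps" if "d < 4" for d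
        using that by (auto simp: block_steps_def)
    qed (simp_all add: 3 block_steps_def)
  qed
qed

lemma block_pos_less:
  assumes "3 \<le> n" "i < n"
  shows "block_pos n i < 12"
  using block_pos_step[OF assms] by (auto simp: block_steps_def)

lemma block_pos_4: "i < 4 \<Longrightarrow> block_pos 4 i = 3 + i"
  by (simp add: block_pos_def)

lemma torus_coloring_blocks:
  assumes mn: "3 \<le> m" "3 \<le> n"
  shows "torus_coloring m n (\<lambda>i j. block_h (block_pos m i) (block_pos n j))
    (\<lambda>i j. block_v (block_pos m i) (block_pos n j))"
  unfolding torus_coloring_def
proof (intro conjI allI impI)
  fix i j assume "i < m" "j < n"
  then have "(block_pos m i, block_pos m (Suc i mod m)) \<in> set block_steps"
    "(block_pos n j, block_pos n (Suc j mod n)) \<in> set block_steps"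
    using block_pos_step mn by auto
  from block_steps_valid[THEN bspec, OF this(1), unfolded case_prod_conv, THEN bspec, OF this(2),
      unfolded case_prod_conv]
  show "distinct [block_h (block_pos m i) (block_pos n (Suc j mod n)),
      block_h (block_pos m (Suc i mod m)) (block_pos n (Suc j mod n)),
      block_v (block_pos m (Suc i mod m)) (block_pos n j),
      block_v (block_pos m (Suc i mod m)) (block_pos n (Suc j mod n))]"
    "distinct [block_h (block_pos m i) (block_pos n j),
      block_h (block_pos m i) (block_pos n (Suc j mod n)),
      block_v (block_pos m i) (block_pos n j),
      block_v (block_pos m (Suc i mod m)) (block_pos n j)]"
    by (rule conjunct1, rule conjunct2)
next
  fix j assume m: "m = 4" and j: "j < n"
  have "inj_on (\<lambda>a. block_h a (block_pos n j)) {3..<7}"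
    using block_4_valid[THEN bspec, of "block_pos n j"] block_pos_less[OF mn(2) j]
    by (simp only: distinct_map set_upt atLeastLessThan_iff zero_le)
  moreover have "inj_on (block_pos m) {..<m}" "block_pos m ` {..<m} \<subseteq> {3..<7}"
    unfolding m by (auto simp: block_pos_4 inj_on_def)
  ultimately show "inj_on (\<lambda>i. block_h (block_pos m i) (block_pos n j)) {..<m}"
    using comp_inj_on[of "block_pos m" "{..<m}" "\<lambda>a. block_h a (block_pos n j)"]
    by (auto simp: comp_def intro: inj_on_subset)
next
  fix i assume n: "n = 4" and i: "i < m"
  have "inj_on (block_v (block_pos m i)) {3..<7}"
    using block_4_valid[THEN bspec, of "block_pos m i"] block_pos_less[OF mn(1) i]
    by (simp only: distinct_map set_upt atLeastLessThan_iff zero_le)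
  moreover have "inj_on (block_pos n) {..<n}" "block_pos n ` {..<n} \<subseteq> {3..<7}"
    unfolding n by (auto simp: block_pos_4 inj_on_def)
  ultimately show "inj_on (\<lambda>j. block_v (block_pos m i) (block_pos n j)) {..<n}"
    using comp_inj_on[of "block_pos n" "{..<n}" "block_v (block_pos m i)"]
    by (auto simp: comp_def intro: inj_on_subset)
qed

section \<open>The rigidity of colorings with four colors\<close>

text \<open>The color of the edge of \<open>C\<^sub>m \<box> C\<^sub>n\<close> whose midpoint is \<open>(x, y)\<close>, unrolled to the plane, becomes
  \<open>F (x + y - 1/2) (x - y - 1/2)\<close>. Both the four edges at a vertex and the four edges
  around a face are then unit squares of the integer lattice.\<close>

definition square_rainbow :: "(int \<Rightarrow> int \<Rightarrow> 'c) \<Rightarrow> bool" where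
  "square_rainbow F \<longleftrightarrow>
    (\<forall>s t. distinct [F s t, F (s + 1) t, F s (t + 1), F (s + 1) (t + 1)])"

lemma square_rainbow_swap:
  assumes "square_rainbow F"
  shows "square_rainbow (\<lambda>s t. F t s)"
  unfolding square_rainbow_def
proof (intro allI)
  fix s t
  have "distinct [F t s, F (t + 1) s, F t (s + 1), F (t + 1) (s + 1)]"
    using assms unfolding square_rainbow_def by blast
  then show "distinct [F t s, F t (s + 1), F (t + 1) s, F (t + 1) (s + 1)]"
    by auto
qed

text \<open>A unit square exhausts the four colors, so one side determines the pair of colors on the
  opposite side.\<close>

lemma square_rainbow_complement:
  assumes F: "square_rainbow F" and S: "range (case_prod F) \<subseteq> S" "card S = 4"
  shows "{F (s + 1) t, F (s + 1) (t + 1)} = S - {F s t, F s (t + 1)}"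
proof -
  let ?X = "{F s t, F (s + 1) t, F s (t + 1), F (s + 1) (t + 1)}"
  have d: "distinct [F s t, F (s + 1) t, F s (t + 1), F (s + 1) (t + 1)]"
    using F unfolding square_rainbow_def by blast
  have "F a b \<in> S" for a b
    using S(1) by auto
  then have "?X \<subseteq> S"
    by blast
  moreover have "card ?X = 4"
    using d by simp
  moreover have "finite S"
    using S(2) card.infinite by fastforce
  ultimately have "?X = S"
    using S(2) card_subset_eq by metis
  then show ?thesis
    using d by auto
qed

text \<open>Let \<open>a, b, c\<close> be consecutive entries of column \<open>s\<close> with
  \<open>a\<close> and \<open>c\<close> different. Beside \<open>a, b\<close> the color
  \<open>c\<close> must occur, and beside \<open>b, c\<close> the color \<open>a\<close>. The middle
  entry of the next column shares a square with each of \<open>a\<close> and \<open>c\<close>, so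
  these appear at the ends, exchanged.\<close>

lemma square_rainbow_column_cross:
  assumes F: "square_rainbow F" and S: "range (case_prod F) \<subseteq> S" "card S = 4"
    and ne: "F s (t + 2) \<noteq> F s t"
  shows "F (s + 1) (t + 2) = F s t \<and> F (s + 1) t = F s (t + 2)"
proof -
  have sq: "distinct [F s t, F (s + 1) t, F s (t + 1), F (s + 1) (t + 1)]"
      "distinct [F s (t + 1), F (s + 1) (t + 1), F s (t + 2), F (s + 1) (t + 2)]"
    using F[unfolded square_rainbow_def, rule_format, of s t]
      F[unfolded square_rainbow_def, rule_format, of s "t + 1"] by (simp_all add: add.assoc)
  have compl: "{F (s + 1) t, F (s + 1) (t + 1)} = S - {F s t, F s (t + 1)}"
      "{F (s + 1) (t + 1), F (s + 1) (t + 2)} = S - {F s (t + 1), F s (t + 2)}"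
    using square_rainbow_complement[OF F S, of s t]
      square_rainbow_complement[OF F S, of s "t + 1"] by (simp_all add: add.assoc)
  have "F s t \<in> S" "F s (t + 2) \<in> S"
    using S(1) by auto
  then have "F s t \<in> {F (s + 1) (t + 1), F (s + 1) (t + 2)}"
    "F s (t + 2) \<in> {F (s + 1) t, F (s + 1) (t + 1)}"
    unfolding compl using sq ne by auto
  then show ?thesis
    using sq by auto
qed

text \<open>Equal pairs have equal complements, which carries a repetition to the next column; a
  failure is carried there by the exchange just shown.\<close>

lemma square_rainbow_column_step:
  assumes F: "square_rainbow F" and S: "range (case_prod F) \<subseteq> S" "card S = 4"
  shows "F (s + 1) (t + 2) = F (s + 1) t \<longleftrightarrow> F s (t + 2) = F s t"
proof
  assume "F (s + 1) (t + 2) = F (s + 1) t"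
  then show "F s (t + 2) = F s t"
    using square_rainbow_column_cross[OF F S] by metis
next
  assume "F s (t + 2) = F s t"
  then have "{F (s + 1) t, F (s + 1) (t + 1)} = {F (s + 1) (t + 1), F (s + 1) (t + 2)}"
    using square_rainbow_complement[OF F S, of s t]
      square_rainbow_complement[OF F S, of s "t + 1"] by (simp add: add.assoc insert_commute)
  then show "F (s + 1) (t + 2) = F (s + 1) t"
    by (auto simp: doubleton_eq_iff)
qed

lemma square_rainbow_column_const:
  assumes F: "square_rainbow F" and S: "range (case_prod F) \<subseteq> S" "card S = 4"
  shows "F s (t + 2) = F s t \<longleftrightarrow> F s0 (t + 2) = F s0 t"
proof (induction s rule: int_induct[where k = s0])
  case (step1 i)
  then show ?case using square_rainbow_column_step[OF F S] by blast
next
  case (step2 i)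
  then show ?case using square_rainbow_column_step[OF F S, of "i - 1" t] by simp
qed simp

text \<open>If the 2-periodicity of the columns fails somewhere, it fails along a whole row, which
  forces that row, and hence all rows, to be 2-periodic.\<close>

lemma square_rainbow_periodic:
  assumes F: "square_rainbow F" and S: "range (case_prod F) \<subseteq> S" "card S = 4"
  shows "(\<forall>s t. F (s + 2) t = F s t) \<or> (\<forall>s t. F s (t + 2) = F s t)"
proof (rule disjCI)
  assume "\<not> (\<forall>s t. F s (t + 2) = F s t)"
  then obtain s0 t0 where "F s0 (t0 + 2) \<noteq> F s0 t0"
    by blast
  then have ne: "F s (t0 + 2) \<noteq> F s t0" for s
    using square_rainbow_column_const[OF F S] by blast
  \<comment> \<open>Two successive exchanges restore the color:
    \<open>F (s + 2) t0 = F (s + 1) (t0 + 2) = F s t0\<close>.\<close>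
  have base: "F (s + 2) t0 = F s t0" for s
    using square_rainbow_column_cross[OF F S ne, of s]
      square_rainbow_column_cross[OF F S ne, of "s + 1"] by (simp add: add.assoc)
  have "range (case_prod (\<lambda>s t. F t s)) \<subseteq> S"
    using S(1) by auto
  \<comment> \<open>In transposed form, constancy carries the periodicity of row \<open>t0\<close>
    to every row.\<close>
  from square_rainbow_column_const[OF square_rainbow_swap[OF F] this S(2)] base
  show "\<forall>s t. F (s + 2) t = F s t"
    by blast
qed

text \<open>A 2-periodic row is described by an unordered pair of colors: moving along the row only
  swaps its entries, and the next row has the complementary pair.\<close>

lemma square_rainbow_row_pair:
  assumes F: "square_rainbow F" and S: "range (case_prod F) \<subseteq> S" "card S = 4"
    and per: "\<And>s t. F (s + 2) t = F s t"
  shows "{F s (t + 2), F (s + 1) (t + 2)} = {F s t, F (s + 1) t}"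
    and "{F s (t + 1), F (s + 1) (t + 1)} \<inter> {F s t, F (s + 1) t} = {}"
    and "{F (s + k) t, F (s + k + 1) t} = {F s t, F (s + 1) t}"
proof -
  have S': "range (case_prod (\<lambda>s t. F t s)) \<subseteq> S"
    using S(1) by auto
  have compl: "{F s (t + 1), F (s + 1) (t + 1)} = S - {F s t, F (s + 1) t}" for s t
    using square_rainbow_complement[OF square_rainbow_swap[OF F] S' S(2), where s = t and t = s] .
  show "{F s (t + 1), F (s + 1) (t + 1)} \<inter> {F s t, F (s + 1) t} = {}"
    unfolding compl[of s t] by blast
  have "{F s t, F (s + 1) t} \<subseteq> S"
    using S(1) by auto
  moreover have "{F s (t + 2), F (s + 1) (t + 2)} = S - (S - {F s t, F (s + 1) t})"
    using compl[of s "t + 1"] unfolding compl[of s t] by (simp only: add.assoc one_add_one)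
  ultimately show "{F s (t + 2), F (s + 1) (t + 2)} = {F s t, F (s + 1) t}"
    by blast
  show "{F (s + k) t, F (s + k + 1) t} = {F s t, F (s + 1) t}"
  proof (induction k rule: int_induct[where k = 0])
    case (step1 i)
    then show ?case
      using per[of "s + i" t] by (simp add: add.assoc insert_commute)
  next
    case (step2 i)
    then show ?case
      using per[of "s + i - 1" t] by (simp add: algebra_simps insert_commute)
  qed simp
qed


section \<open>Restrictions on the lengths of the cycles\<close>

lemma int_periodic:
  assumes "\<And>x. g (x + p) = g x"
  shows "g (x + p * k) = g (x :: int)"
proof (induction k rule: int_induct[where k = 0])
  case (step1 i)
  then show ?case
    using assms[of "x + p * i"] by (simp add: algebra_simps)
next
  case (step2 i)
  then show ?case
    using assms[of "x + p * (i - 1)"] by (simp add: algebra_simps)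
qed simp

text \<open>One turn around the torus, the shift \<open>diag\<close>, identifies row 0 with row
  \<open>m\<close>, so both have the same pair of colors. An odd number of complements would make
  the two pairs disjoint.\<close>

lemma square_rainbow_period_even:
  assumes F: "square_rainbow F" and S: "range (case_prod F) \<subseteq> S" "card S = 4"
    and diag: "\<And>s t. F (s + m) (t + m) = F s t"
  shows "even m"
proof -
  \<comment> \<open>Stated for every \<open>F\<close>, so that it also serves the transposed pattern
    when the columns are the periodic lines.\<close>
  have *: "even m" if F: "square_rainbow F" and S: "range (case_prod F) \<subseteq> S"
    and diag: "\<And>s t. F (s + m) (t + m) = F s t" and per: "\<And>s t. F (s + 2) t = F s t" for F
  proof (rule ccontr)
    assume "odd m"
    then obtain k where k: "m = 2 * k + 1"
      by (rule oddE)
    note pair = square_rainbow_row_pair[OF F S \<open>card S = 4\<close> per]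
    define Q where "Q t = {F 0 t, F 1 t}" for t
    have "Q (t + 2) = Q t" for t
      using pair(1)[of 0 t] by (simp add: Q_def)
    then have "Q (1 + 2 * k) = Q 1"
      by (rule int_periodic)
    \<comment> \<open>Row \<open>m\<close> read from column 0 is row 0 read from column
      \<open>- m\<close>.\<close>
    moreover have "Q m = {F (- m) 0, F (- m + 1) 0}"
      using diag[of "- m" 0] diag[of "- m + 1" 0] by (simp add: Q_def)
    then have "Q m = Q 0"
      using pair(3)[of 0 "- m" 0] by (simp add: Q_def)
    moreover have "Q 1 \<inter> Q 0 = {}"
      using pair(2)[of 0 0] by (simp add: Q_def)
    moreover have "Q 0 \<noteq> {}"
      by (simp add: Q_def)
    ultimately show False
      by (simp add: k add.commute)
  qed
  from square_rainbow_periodic[OF F S] show ?thesis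
  proof
    assume "\<forall>s t. F (s + 2) t = F s t"
    then show ?thesis
      using *[OF F S(1) diag] by blast
  next
    assume "\<forall>s t. F s (t + 2) = F s t"
    then show ?thesis
      using *[OF square_rainbow_swap[OF F] _ diag] S(1) by (force simp: image_subset_iff)
  qed
qed

text \<open>\<open>ne\<close> will come from rainbow rows of length 4, and \<open>anti\<close> is
  one turn in the other direction. If rows are 2-periodic, rows \<open>t\<close> and
  \<open>t + 2\<close> share their two colors, so \<open>ne\<close> forces an exchange. Two
  exchanges give period 4 in \<open>t\<close>, against the turn of length
  \<open>n = 2 + 4 * k\<close>.\<close>

lemma square_rainbow_not_2_mod_4:
  assumes F: "square_rainbow F" and S: "range (case_prod F) \<subseteq> S" "card S = 4"
    and ne: "\<And>s t. even (s + t) \<Longrightarrow> F (s + 2) (t + 2) \<noteq> F s t"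
    and anti: "\<And>s t. F (s + n) (t - n) = F s t"
  shows "n mod 4 \<noteq> 2"
proof
  assume "n mod 4 = 2"
  then obtain k where n: "n = 2 + 4 * k"
    by (metis add.commute mult_div_mod_eq)
  have *: False if F: "square_rainbow F" and S: "range (case_prod F) \<subseteq> S"
    and ne: "\<And>s t. even (s + t) \<Longrightarrow> F (s + 2) (t + 2) \<noteq> F s t"
    and anti: "\<And>s t. F (s + n) (t - n) = F s t" and per: "\<And>s t. F (s + 2) t = F s t" for F
  proof -
    note pair = square_rainbow_row_pair[OF F S \<open>card S = 4\<close> per]
    have ne': "F s (t + 2) \<noteq> F s t" if "even (s + t)" for s t
      using ne[OF that] per by simp
    \<comment> \<open>In column 0 only even rows are used, since \<open>ne\<close> requires
      \<open>s + t\<close> to be even.\<close>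
    have "F 0 (2 * (u + 2)) = F 0 (2 * u)" for u
    proof -
      have "F 0 (2 * u + 2) \<noteq> F 0 (2 * u)" "F 0 (2 * u + 4) \<noteq> F 0 (2 * u + 2)"
        using ne'[of 0 "2 * u"] ne'[of 0 "2 * u + 2"] by (simp_all add: add.assoc)
      moreover have "{F 0 (2 * u + 2), F 1 (2 * u + 2)} = {F 0 (2 * u), F 1 (2 * u)}"
        "{F 0 (2 * u + 4), F 1 (2 * u + 4)} = {F 0 (2 * u + 2), F 1 (2 * u + 2)}"
        using pair(1)[of 0 "2 * u"] pair(1)[of 0 "2 * u + 2"] by (simp_all add: add.assoc)
      ultimately have "F 0 (2 * u + 4) = F 0 (2 * u)"
        by (metis doubleton_eq_iff)
      then show ?thesis
        by (simp add: algebra_simps)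
    qed
    then have "F 0 (2 * (1 + 2 * k)) = F 0 (2 * 1)"
      by (rule int_periodic)
    then have "F 0 n = F 0 2"
      unfolding n by simp
    \<comment> \<open>Since \<open>n\<close> is even, the shift along the row that is part of
      \<open>anti\<close> changes nothing: \<open>F 0 n = F n 0 = F 0 0\<close>.\<close>
    moreover have "F (0 + 2 * (1 + 2 * k)) 0 = F 0 0"
      by (rule int_periodic[where g = "\<lambda>s. F s 0"]) (rule per)
    then have "F n 0 = F 0 0"
      unfolding n by simp
    then have "F 0 n = F 0 0"
      using anti[of 0 n] by simp
    ultimately show False
      using ne'[of 0 0] by simp
  qed
  from square_rainbow_periodic[OF F S] show False
  proof
    assume "\<forall>s t. F (s + 2) t = F s t"
    then show ?thesis
      using *[OF F S(1) ne anti] by blast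
  next
    assume per: "\<forall>s t. F s (t + 2) = F s t"
    show ?thesis
    proof (rule *)
      show "square_rainbow (\<lambda>s t. F t s)"
        using F by (rule square_rainbow_swap)
      show "range (case_prod (\<lambda>s t. F t s)) \<subseteq> S"
        using S(1) by auto
      show "F (t + 2) (s + 2) \<noteq> F t s" if "even (s + t)" for s t
        using ne[of t s] that by (simp add: add.commute)
      show "F (t - n) (s + n) = F t s" for s t
        using anti[of "t - n" "s + n"] by simp
      show "F t (s + 2) = F t s" for s t
        using per by blast
    qed
  qed
qed

section \<open>Unrolling the torus to the plane\<close>

lemma nat_mod_add_1:
  assumes "0 < m"
  shows "nat ((x + 1) mod int m) = Suc (nat (x mod int m)) mod m"
proof -
  have "int (Suc (nat (x mod int m)) mod m) = (x mod int m + 1) mod int m"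
    using assms by (simp add: zmod_int add.commute)
  then show ?thesis
    by (simp add: mod_add_left_eq)
qed

text \<open>In the tilted coordinates, adding \<open>m\<close> to \<open>x\<close> moves
  \<open>(s, t)\<close> by \<open>(m, m)\<close>, and adding \<open>n\<close> to \<open>y\<close>
  moves it by \<open>(n, - n)\<close>; this is the origin of the two diagonal periods.\<close>

lemma torus_coloring_medial:
  fixes h v :: "nat \<Rightarrow> nat \<Rightarrow> 'c"
  assumes mn: "3 \<le> m" "3 \<le> n" and T: "torus_coloring m n h v"
    and S: "\<And>i j. i < m \<Longrightarrow> j < n \<Longrightarrow> h i j \<in> S \<and> v i j \<in> S"
  obtains F where "square_rainbow F" "range (case_prod F) \<subseteq> S"
    "\<And>s t. F (s + int m) (t + int m) = F s t" "\<And>s t. F (s + int n) (t - int n) = F s t"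
    "\<And>s t. m = 4 \<Longrightarrow> even (s + t) \<Longrightarrow> F (s + 2) (t + 2) \<noteq> F s t"
proof -
  define X where "X x = nat (x mod int m)" for x
  define Y where "Y y = nat (y mod int n)" for y
  define H where "H x y = h (X x) (Y y)" for x y
  define V where "V x y = v (X x) (Y y)" for x y
  define F where "F s t = (if even (s + t) then H ((s + t) div 2) ((s - t) div 2)
    else V ((s + t + 1) div 2) ((s - t - 1) div 2))" for s t
  have XY: "X x < m" "Y y < n" for x y
    using mn by (simp_all add: X_def Y_def nat_less_iff)
  have X1: "X (x + 1) = Suc (X x) mod m" for x
    unfolding X_def using mn by (intro nat_mod_add_1) simp
  have Y1: "Y (y + 1) = Suc (Y y) mod n" for y
    unfolding Y_def using mn by (intro nat_mod_add_1) simp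
  have vertex: "distinct [H x (y + 1), H (x + 1) (y + 1), V (x + 1) y, V (x + 1) (y + 1)]"
    and face: "distinct [H x y, H x (y + 1), V x y, V (x + 1) y]" for x y
    unfolding H_def V_def X1 Y1
    using T[unfolded torus_coloring_def, THEN conjunct1, rule_format, OF XY(1)[of x] XY(2)[of y]]
    by (rule conjunct1, rule conjunct2)
  have FH: "F s t = H x y" if "s = x + y" "t = x - y" for s t x y
    unfolding F_def that by simp
  have FV: "F s t = V x y" if "s = x + y" "t = x - y - 1" for s t x y
    unfolding F_def that by simp
  \<comment> \<open>Even \<open>s + t\<close> marks horizontal edges, odd \<open>s + t\<close>
    vertical ones.\<close>
  have cases: thesis if "\<And>x y. s = x + y \<Longrightarrow> t = x - y \<Longrightarrow> thesis"
    "\<And>x y. s = x + y \<Longrightarrow> t = x - y - 1 \<Longrightarrow> thesis" for s t :: int and thesis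
  proof (cases "even (s + t)")
    case True
    then have "s = (s + t) div 2 + (s - t) div 2" "t = (s + t) div 2 - (s - t) div 2"
      by presburger+
    then show ?thesis by (rule that(1))
  next
    case False
    then have "s = (s + t + 1) div 2 + (s - t - 1) div 2" "t = (s + t + 1) div 2 - (s - t - 1) div 2 - 1"
      by presburger+
    then show ?thesis by (rule that(2))
  qed
  have Hm: "H (x + int m) y = H x y" "V (x + int m) y = V x y" for x y
    unfolding H_def V_def X_def by simp_all
  have Hn: "H x (y + int n) = H x y" "V x (y + int n) = V x y" for x y
    unfolding H_def V_def Y_def by simp_all
  show thesis
  proof (rule that[of F])
    show "square_rainbow F"
      unfolding square_rainbow_def
    proof (intro allI)
      fix s t
      show "distinct [F s t, F (s + 1) t, F s (t + 1), F (s + 1) (t + 1)]"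
      proof (rule cases[of s t])
        \<comment> \<open>This square surrounds the vertex \<open>(x + 1, y)\<close>; the second
          index below is \<open>y - 1\<close> because \<open>vertex\<close> is stated at
          successors.\<close>
        fix x y assume st: "s = x + y" "t = x - y"
        have "F s t = H x y" "F (s + 1) t = V (x + 1) y" "F s (t + 1) = V (x + 1) (y - 1)"
          "F (s + 1) (t + 1) = H (x + 1) y"
          using st by (auto intro!: FH FV)
        then show ?thesis
          using vertex[of x "y - 1"] by auto
      next
        \<comment> \<open>This square is the face with lower left corner
          \<open>(x, y)\<close>.\<close>
        fix x y assume st: "s = x + y" "t = x - y - 1"
        have "F s t = V x y" "F (s + 1) t = H x (y + 1)" "F s (t + 1) = H x y"
          "F (s + 1) (t + 1) = V (x + 1) y"
          using st by (auto intro!: FH FV)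
        then show ?thesis
          using face[of x y] by auto
      qed
    qed
    show "range (case_prod F) \<subseteq> S"
      using S XY by (auto simp: F_def H_def V_def)
    show "F (s + int m) (t + int m) = F s t" for s t
    proof (rule cases[of s t])
      fix x y assume "s = x + y" "t = x - y"
      then show ?thesis
        using FH[of "s + int m" "x + int m" y "t + int m"] FH[of s x y t] Hm by simp
    next
      fix x y assume "s = x + y" "t = x - y - 1"
      then show ?thesis
        using FV[of "s + int m" "x + int m" y "t + int m"] FV[of s x y t] Hm by simp
    qed
    show "F (s + int n) (t - int n) = F s t" for s t
    proof (rule cases[of s t])
      fix x y assume "s = x + y" "t = x - y"
      then show ?thesis
        using FH[of "s + int n" x "y + int n" "t - int n"] FH[of s x y t] Hn by simp
    next
      fix x y assume "s = x + y" "t = x - y - 1"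
      then show ?thesis
        using FV[of "s + int n" x "y + int n" "t - int n"] FV[of s x y t] Hn by simp
    qed
    show "F (s + 2) (t + 2) \<noteq> F s t" if m: "m = 4" and "even (s + t)" for s t
    proof -
      obtain x y where st: "s = x + y" "t = x - y"
      proof
        show "s = (s + t) div 2 + (s - t) div 2" "t = (s + t) div 2 - (s - t) div 2"
          using \<open>even (s + t)\<close> by presburger+
      qed
      \<comment> \<open>The shift by \<open>(2, 2)\<close> goes two steps along a row, to the
        opposite edge of a row of length 4.\<close>
      have "F s t = H x y" "F (s + 2) (t + 2) = H (x + 2) y"
        using st by (auto intro!: FH)
      moreover have "inj_on (\<lambda>i. h i (Y y)) {..<m}"
        using T m XY unfolding torus_coloring_def by blast
      moreover have "X (x + 2) \<noteq> X x"
      proof -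
        have "(x + 2) mod 4 \<noteq> x mod 4"
          by presburger
        then show ?thesis
          unfolding X_def m by simp
      qed
      ultimately show ?thesis
        using XY unfolding H_def by (metis inj_onD lessThan_iff)
    qed
  qed
qed

text \<open>The parity of \<open>n\<close> and the case \<open>n = 4\<close> follow by applying this
  to the swapped coloring.\<close>

lemma torus_coloring_4_colors:
  assumes mn: "3 \<le> m" "3 \<le> n" and T: "torus_coloring m n h v"
    and S: "\<And>i j. i < m \<Longrightarrow> j < n \<Longrightarrow> h i j \<in> S \<and> v i j \<in> S" "card S = 4"
  shows "even m" and "m = 4 \<Longrightarrow> n mod 4 \<noteq> 2"
proof -
  obtain F where F: "square_rainbow F" "range (case_prod F) \<subseteq> S"
    "\<And>s t. F (s + int m) (t + int m) = F s t" "\<And>s t. F (s + int n) (t - int n) = F s t"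
    "\<And>s t. m = 4 \<Longrightarrow> even (s + t) \<Longrightarrow> F (s + 2) (t + 2) \<noteq> F s t"
    using torus_coloring_medial[OF mn T S(1)] by metis
  show "even m"
    using square_rainbow_period_even[OF F(1,2) S(2) F(3)] by simp
  assume "m = 4"
  then have "int n mod 4 \<noteq> 2"
    using square_rainbow_not_2_mod_4[OF F(1,2) S(2) F(5) F(4)] by blast
  then show "n mod 4 \<noteq> 2"
    by (metis of_nat_mod of_nat_numeral)
qed

section \<open>Combining the bounds\<close>

theorem theorem1p4:
  fixes m n :: nat
  assumes "m \<ge> 3" and "n \<ge> 3"
  shows "q\<^sub>B (cycle_graph m \<box> cycle_graph n) =
    (if odd m \<or> odd n then 5
     else if \<exists>k\<ge>1. {m, n} = {4, 4 * k + 2} then 5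
     else 4)"
proof -
  let ?G = "cycle_graph m \<box> cycle_graph n"
  note mn = assms
  have exceptional: "(\<exists>k\<ge>1. {m, n} = {4, 4 * k + 2}) \<longleftrightarrow> m = 4 \<and> n mod 4 = 2 \<or> n = 4 \<and> m mod 4 = 2"
  proof
    assume "\<exists>k\<ge>1. {m, n} = {4, 4 * k + 2}"
    then obtain k where "m = 4 \<and> n = 4 * k + 2 \<or> n = 4 \<and> m = 4 * k + 2"
      by (auto simp: doubleton_eq_iff)
    moreover have "(4 * k + 2) mod 4 = 2"
      by presburger
    ultimately show "m = 4 \<and> n mod 4 = 2 \<or> n = 4 \<and> m mod 4 = 2"
      by metis
  next
    \<comment> \<open>The bound on \<open>x\<close> rules out the value 2, so \<open>x div 4\<close>
      is at least 1.\<close>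
    have *: "\<exists>k\<ge>1. x = 4 * k + 2" if "x mod 4 = 2" "3 \<le> x" for x :: nat
      using that by (intro exI[of _ "x div 4"]) presburger
    assume "m = 4 \<and> n mod 4 = 2 \<or> n = 4 \<and> m mod 4 = 2"
    then show "\<exists>k\<ge>1. {m, n} = {4, 4 * k + 2}"
      using *[of m] *[of n] mn by (auto simp: insert_commute)
  qed
  have le5: "q\<^sub>B ?G \<le> 5"
  proof (rule B_coloring_number_torus_le[OF mn torus_coloring_blocks[OF mn]])
    show "block_h (block_pos m i) (block_pos n j) < 5 \<and> block_v (block_pos m i) (block_pos n j) < 5"
      if "i < m" "j < n" for i j
      using block_colors block_pos_less[OF mn(1) that(1)] block_pos_less[OF mn(2) that(2)] by simp
  qed
  have "simple_graph ?G"
    by (intro simple_graph_cart_prod simple_graph_cycle_graph mn)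
  from B_coloring_number_attained[OF this]
  obtain c :: "(nat \<times> nat) set \<Rightarrow> nat" where B: "B_coloring ?G c" and card: "card (c ` edges ?G) = q\<^sub>B ?G"
    by blast
  note T = torus_coloring_of_B_coloring[OF mn B]
  let ?S = "c ` edges ?G"
  have S: "c (hedge m i j) \<in> ?S \<and> c (vedge n i j) \<in> ?S" if "i < m" "j < n" for i j
    using that unfolding edges_torus by blast
  have "0 < m" "0 < n"
    using mn by auto
  \<comment> \<open>The face at \<open>(0, 0)\<close> supplies the four different colors for the
    lower bound.\<close>
  note T0 = T[unfolded torus_coloring_def, THEN conjunct1, rule_format, OF this, THEN conjunct2]
  have ge4: "4 \<le> q\<^sub>B ?G"
  proof -
    let ?L = "[c (hedge m 0 0), c (hedge m 0 (Suc 0 mod n)), c (vedge n 0 0), c (vedge n (Suc 0 mod m) 0)]"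
    have "set ?L \<subseteq> ?S"
      using S mn by simp
    moreover have "finite ?S"
      using card_gt_0_iff mn unfolding edges_torus by (simp add: finite_image_set2)
    ultimately have "card (set ?L) \<le> card ?S"
      by (rule card_mono[rotated])
    then show ?thesis
      using distinct_card[OF T0] card by simp
  qed
  have not4: "even m \<and> even n \<and> \<not> (m = 4 \<and> n mod 4 = 2 \<or> n = 4 \<and> m mod 4 = 2)" if "q\<^sub>B ?G = 4"
  proof -
    have S4: "card ?S = 4"
      using that card by simp
    show ?thesis
      using torus_coloring_4_colors[OF mn T S S4]
        torus_coloring_4_colors[OF mn(2,1) torus_coloring_swap[OF T] _ S4] S by blast
  qed
  \<comment> \<open>If one length is 4, the assumptions make both lengths multiples of 4 and the
    pattern modulo 4 applies; otherwise the checkerboard does.\<close>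
  have le4: "q\<^sub>B ?G \<le> 4" if even: "even m" "even n" and ex: "\<not> (m = 4 \<and> n mod 4 = 2 \<or> n = 4 \<and> m mod 4 = 2)"
  proof (cases "m = 4 \<or> n = 4")
    case True
    have dvd: "4 dvd x" if "even x" "x mod 4 \<noteq> 2" for x :: nat
      using that by presburger
    have "m mod 4 \<noteq> 2" "n mod 4 \<noteq> 2"
      using True ex by auto
    from dvd[OF even(1) this(1)] dvd[OF even(2) this(2)] have "4 dvd m" "4 dvd n" .
    then show ?thesis
      by (intro B_coloring_number_torus_le[OF mn torus_coloring_mod4[OF mn]]) simp_all
  next
    case False
    have "(i + j) mod 2 < 4 \<and> 2 + (i + j) mod 2 < 4" for i j :: nat
    proof -
      have "(i + j) mod 2 < 2"
        by simp
      then show ?thesis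
        by linarith
    qed
    then show ?thesis
      using False by (intro B_coloring_number_torus_le[OF mn torus_coloring_parity[OF mn even]]) simp_all
  qed
  show ?thesis
    unfolding exceptional
  proof (cases "even m \<and> even n \<and> \<not> (m = 4 \<and> n mod 4 = 2 \<or> n = 4 \<and> m mod 4 = 2)")
    case True
    then have "q\<^sub>B ?G = 4"
      using le4 ge4 by (intro antisym) blast+
    then show "q\<^sub>B ?G = (if odd m \<or> odd n then 5
      else if m = 4 \<and> n mod 4 = 2 \<or> n = 4 \<and> m mod 4 = 2 then 5 else 4)"
      using True by metis
  next
    case False
    then have "q\<^sub>B ?G \<noteq> 4"
      using not4 by blast
    then have "q\<^sub>B ?G = 5"
      using le5 ge4 by linarith
    then show "q\<^sub>B ?G = (if odd m \<or> odd n then 5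
      else if m = 4 \<and> n mod 4 = 2 \<or> n = 4 \<and> m mod 4 = 2 then 5 else 4)"
      using False by metis
  qed
qed

end
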